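(* Let $\alpha\in(0,1]$, let $X$ be a Banach space and let $A$ be the infinitesimal generator of a $c_0$-$\alpha$-semigroup $\{T(t)\}_{t\ge0}\subseteq\mathcal{L}(X,X)$. If $u_0\in D(A)$, then the $\alpha$-abstract Cauchy problem $$u^{(\alpha)}(t)=Au(t),\quad t>0,\qquad u(0)=u_0,$$ has one and only one solution $u:[0,\infty)\to X$, namely $$u(t)=T(t)u_0 .$$
   Context: $\mathcal{L}(X,X)$ is the space of bounded linear operators on $X$. Conformable fractional derivative: for $\alpha\in(0,1]$ and a function $f$ on $[0,\infty)$ with values in $\mathbb{R}$ or in a Banach space (limits in norm), set, for $t>0$, $$f^{(\alpha)}(t)=\lim_{\varepsilon\to 0}\frac{f(t+\varepsilon t^{1-\alpha})-f(t)}{\varepsilon}$$ when the limit exists ($f$ is then called $\alpha$-differentiable at $t$). If $f$ is $\alpha$-differentiable on some $(0,b)$, $b>0$, and $\lim_{t\to 0^+}f^{(\alpha)}(t)$ exists, then $f^{(\alpha)}(0):=\lim_{t\to0^+}f^{(\alpha)}(t)$. A family $\{T(t)\}_{t\ge0}\subseteq\mathcal{L}(X,X)$ is a (fractional) $\alpha$-semigroup if $T(0)=I$ and $T\big((s+t)^{1/\alpha}\big)=T\big(s^{1/\alpha}\big)T\big(t^{1/\alpha}\big)$ for all $s,t\in[0,\infty)$. It is a $c_0$-$\alpha$-semigroup if in addition, for each fixed $x\in X$, $T(t)x\to x$ as $t\to0^+$. For $x\in X$, $T^{(\alpha)}(t)x$ denotes the conformable $\alpha$-derivative at $t$ of the $X$-valued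 function $t\mapsto T(t)x$. The ($\alpha$-)infinitesimal generator $A$ of the $\alpha$-semigroup is its conformable $\alpha$-derivative at $t=0$: $D(A)=\{x\in X:\lim_{t\to0^+}T^{(\alpha)}(t)x \text{ exists}\}$ (so $T^{(\alpha)}(t)x$ exists for all $t$ in some interval $(0,b)$), and $Ax=T^{(\alpha)}(0)x=\lim_{t\to0^+}T^{(\alpha)}(t)x$ for $x\in D(A)$. For a linear operator $A:D(A)\subseteq X\to X$ and $u_0\in X$, a function $u:[0,\infty)\to X$ is a solution of the $\alpha$-abstract Cauchy problem $u^{(\alpha)}(t)=Au(t)$ for $t>0$, $u(0)=u_0$, if: (i) $u$ is continuous on $[0,\infty)$; (ii) $u$ is continuously $\alpha$-differentiable on $(0,\infty)$ (i.e. $u^{(\alpha)}$ exists and is continuous there); (iii) $u(t)\in D(A)$ for $t>0$; (iv) $u$ satisfies $u^{(\alpha)}(t)=Au(t)$ for $t>0$ and $u(0)=u_0$. *)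

theory Defs
  imports "HOL-Analysis.Analysis"
begin

text \<open>
  Functions on \<open>[0,\<infinity>)\<close> are rendered as functions on \<^typ>\<open>real\<close> whose values at negative
  arguments are irrelevant.  In the first clause \<open>t > 0\<close>, so for small \<open>\<epsilon>\<close> of either sign the
  argument \<open>t + \<epsilon> t\<^sup>1\<^sup>-\<^sup>\<alpha>\<close> is positive.  At \<open>t = 0\<close> the derivative is by convention the right-hand
  limit of the derivatives \<open>g s\<close> at points \<open>s > 0\<close>.
\<close>

definition has_conf_deriv ::
  "real \<Rightarrow> (real \<Rightarrow> 'a::real_normed_vector) \<Rightarrow> 'a \<Rightarrow> real \<Rightarrow> bool"
where
  "has_conf_deriv \<alpha> f D t \<longleftrightarrow>
    (if t > 0
     then ((\<lambda>\<epsilon>. (f (t + \<epsilon> * t powr (1 - \<alpha>)) - f t) /\<^sub>R \<epsilon>) \<longlongrightarrow> D) (at 0)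
     else t = 0 \<and>
       (\<exists>b>0. \<exists>g.
          (\<forall>s\<in>{0<..<b}.
             ((\<lambda>\<epsilon>. (f (s + \<epsilon> * s powr (1 - \<alpha>)) - f s) /\<^sub>R \<epsilon>) \<longlongrightarrow> g s) (at 0)) \<and>
          (g \<longlongrightarrow> D) (at_right 0)))"

definition conf_differentiable ::
  "real \<Rightarrow> (real \<Rightarrow> 'a::real_normed_vector) \<Rightarrow> real \<Rightarrow> bool"
where
  "conf_differentiable \<alpha> f t \<longleftrightarrow> (\<exists>D. has_conf_deriv \<alpha> f D t)"

definition conf_deriv ::
  "real \<Rightarrow> (real \<Rightarrow> 'a::real_normed_vector) \<Rightarrow> real \<Rightarrow> 'a"
where
  "conf_deriv \<alpha> f t = (THE D. has_conf_deriv \<alpha> f D t)"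

definition alpha_semigroup ::
  "real \<Rightarrow> (real \<Rightarrow> 'a::real_normed_vector \<Rightarrow>\<^sub>L 'a) \<Rightarrow> bool"
where
  "alpha_semigroup \<alpha> T \<longleftrightarrow>
    T 0 = id_blinfun \<and>
    (\<forall>s\<ge>0. \<forall>t\<ge>0. T ((s + t) powr (1 / \<alpha>)) = T (s powr (1 / \<alpha>)) o\<^sub>L T (t powr (1 / \<alpha>)))"

definition c0_alpha_semigroup ::
  "real \<Rightarrow> (real \<Rightarrow> 'a::real_normed_vector \<Rightarrow>\<^sub>L 'a) \<Rightarrow> bool"
where
  "c0_alpha_semigroup \<alpha> T \<longleftrightarrow>
    alpha_semigroup \<alpha> T \<and>
    (\<forall>x. ((\<lambda>t. blinfun_apply (T t) x) \<longlongrightarrow> x) (at_right 0))"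

definition generator_domain ::
  "real \<Rightarrow> (real \<Rightarrow> 'a::real_normed_vector \<Rightarrow>\<^sub>L 'a) \<Rightarrow> 'a set"
where
  "generator_domain \<alpha> T = {x. conf_differentiable \<alpha> (\<lambda>t. blinfun_apply (T t) x) 0}"

text \<open>Only the values on \<open>generator_domain \<alpha> T\<close> are meaningful.\<close>

definition generator ::
  "real \<Rightarrow> (real \<Rightarrow> 'a::real_normed_vector \<Rightarrow>\<^sub>L 'a) \<Rightarrow> 'a \<Rightarrow> 'a"
where
  "generator \<alpha> T x = conf_deriv \<alpha> (\<lambda>t. blinfun_apply (T t) x) 0"

text \<open>The (possibly unbounded) operator is given by its domain \<open>DA\<close> and a function \<open>A\<close>, used only
  at points of \<open>DA\<close>.\<close>

definition cauchy_solution ::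
  "real \<Rightarrow> 'a set \<Rightarrow> ('a \<Rightarrow> 'a) \<Rightarrow> 'a \<Rightarrow> (real \<Rightarrow> 'a::real_normed_vector) \<Rightarrow> bool"
where
  "cauchy_solution \<alpha> DA A u\<^sub>0 u \<longleftrightarrow>
    continuous_on {0..} u \<and>
    (\<forall>t>0. conf_differentiable \<alpha> u t) \<and>
    continuous_on {0<..} (conf_deriv \<alpha> u) \<and>
    (\<forall>t>0. u t \<in> DA) \<and>
    (\<forall>t>0. conf_deriv \<alpha> u t = A (u t)) \<and>
    u 0 = u\<^sub>0"

end

theory Submission
  imports Defs
begin

text \<open>
  The substitution \<open>S r = T (r\<^bsup>1/\<alpha>\<^esup>)\<close> turns a \<open>c\<^sub>0\<close>-\<open>\<alpha>\<close>-semigroup into an ordinary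
  \<open>c\<^sub>0\<close>-semigroup and the conformable derivative of \<open>f\<close> at \<open>t\<close> into \<open>\<alpha>\<close> times the ordinary
  derivative of \<open>r \<mapsto> f (r\<^bsup>1/\<alpha>\<^esup>)\<close> at \<open>t\<^sup>\<alpha>\<close>.  The mean value inequality identifies the limit of
  derivatives at \<open>0\<close> with the right derivative at \<open>0\<close>, so the two generators agree up to the
  factor \<open>\<alpha>\<close>.  It remains to treat the classical Cauchy problem; uniqueness there holds because
  \<open>s \<mapsto> S (t - s) (w s)\<close> has derivative zero for every solution \<open>w\<close>.
\<close>

section \<open>Uniform boundedness\<close>

text \<open>Baire category: by pointwise boundedness the closed sets \<open>C k\<close> cover the
  space, so one of them contains a ball, and linearity turns the common bound on that ball into a
  bound on the operator norms.\<close>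

theorem uniform_boundedness:
  fixes F :: "'i \<Rightarrow> 'a::banach \<Rightarrow>\<^sub>L 'b::real_normed_vector"
  assumes "\<And>x. bounded ((\<lambda>i. F i x) ` I)"
  shows "bounded (F ` I)"
proof -
  define C where "C k = {x. \<forall>i\<in>I. norm (F i x) \<le> real k}" for k :: nat
  have clC: "closed (C k)" for k
  proof -
    have "C k = (\<Inter>i\<in>I. {x. norm (F i x) \<le> real k})" by (auto simp: C_def)
    thus ?thesis by (simp add: closed_INT closed_Collect_le blinfun.continuous_on continuous_on_norm)
  qed
  have "\<exists>k. x \<in> C k" for x
  proof -
    obtain B where B: "\<forall>i\<in>I. norm (F i x) \<le> B"
      using assms[of x] by (auto simp: bounded_iff)
    obtain k :: nat where "B \<le> real k" using real_arch_simple by blast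
    with B show ?thesis unfolding C_def by (force intro: order_trans)
  qed
  hence UN: "\<Union>(range C) = UNIV" by auto
  have "\<exists>k. interior (C k) \<noteq> {}"
  proof (rule ccontr)
    assume "\<nexists>k. interior (C k) \<noteq> {}"
    hence "(euclidean::'a topology) interior_of \<Union>(range C) = {}"
      by (intro Baire_category_alt)
        (auto simp: clC completely_metrizable_space_euclidean)
    thus False by (simp add: UN)
  qed
  then obtain k a where "a \<in> interior (C k)" by blast
  then obtain e where e: "e > 0" "cball a e \<subseteq> C k"
    using mem_interior_cball by metis
  have "norm (F i) \<le> 2 * real k / e" if i: "i \<in> I" for i
  proof (rule norm_blinfun_bound)
    fix x
    show "norm (F i x) \<le> 2 * real k / e * norm x"
    proof (cases "x = 0")
      case False
      \<comment> \<open>Scaling \<open>x\<close> to norm \<open>e\<close> keeps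
        \<open>a + c *\<^sub>R x\<close> in the ball. The image of \<open>c *\<^sub>R x\<close> is
        then a difference of two vectors of norm at most \<open>k\<close>, whence the constant
        \<open>2 * real k / e\<close>.\<close>
      define c where "c = e / norm x"
      have c: "c > 0" "norm (c *\<^sub>R x) = e" using False e by (auto simp: c_def)
      have "a + c *\<^sub>R x \<in> C k" "a \<in> C k"
        using e c by (auto simp: subset_iff dist_norm)
      hence *: "norm (F i (a + c *\<^sub>R x)) \<le> k" "norm (F i a) \<le> k"
        using i by (auto simp: C_def)
      have "c * norm (F i x) = norm (F i (a + c *\<^sub>R x) - F i a)"
        using c by (simp add: blinfun.add_right blinfun.scaleR_right)
      also have "\<dots> \<le> 2 * real k"
        using norm_triangle_ineq4[of "F i (a + c *\<^sub>R x)" "F i a"] * by linarith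
      finally show ?thesis
        using c False e by (simp add: c_def field_simps)
    qed simp
  qed (use e in simp)
  thus ?thesis by (auto simp: bounded_iff)
qed

section \<open>Difference quotients\<close>

text \<open>Bridges the remainder form of the derivative and the difference quotients in which
  conformable derivatives and generators are defined.\<close>

lemma has_vector_derivative_iff_quotient:
  "(f has_vector_derivative D) (at t) \<longleftrightarrow> ((\<lambda>h. (f (t + h) - f t) /\<^sub>R h) \<longlongrightarrow> D) (at 0)"
proof -
  have "((\<lambda>h. norm (f (t + h) - f t - h *\<^sub>R D) / norm h) \<longlongrightarrow> 0) (at 0) \<longleftrightarrow>
        ((\<lambda>h. norm ((f (t + h) - f t) /\<^sub>R h - D)) \<longlongrightarrow> 0) (at 0)"
  proof (rule filterlim_cong[OF refl refl])
    have "norm (f (t + h) - f t - h *\<^sub>R D) / norm h = norm ((f (t + h) - f t) /\<^sub>R h - D)"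
      if "h \<noteq> 0" for h
    proof -
      have *: "(f (t + h) - f t) /\<^sub>R h - D = (f (t + h) - f t - h *\<^sub>R D) /\<^sub>R h"
        using that by (simp add: scaleR_diff_right)
      show ?thesis unfolding * by (simp add: divide_inverse mult.commute)
    qed
    thus "\<forall>\<^sub>F h in at 0. norm (f (t + h) - f t - h *\<^sub>R D) / norm h
        = norm ((f (t + h) - f t) /\<^sub>R h - D)"
      by (auto simp: eventually_at_filter)
  qed
  thus ?thesis
    by (simp add: has_vector_derivative_def has_derivative_at bounded_linear_scaleR_left
        tendsto_norm_zero_iff LIM_zero_iff)
qed

text \<open>The mean value inequality is applied to \<open>w r - r *\<^sub>R L\<close>, whose
  derivative \<open>g r - L\<close> is small near 0. This links the convention for the conformable
  derivative at 0 to a genuine right derivative.\<close>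

lemma right_derivative_eq_limit_of_derivatives:
  fixes w :: "real \<Rightarrow> 'a::real_normed_vector"
  assumes b: "b > 0" and cont: "continuous_on {0..<b} w"
    and der: "\<And>r. 0 < r \<Longrightarrow> r < b \<Longrightarrow> (w has_vector_derivative g r) (at r)"
    and lim: "(g \<longlongrightarrow> L) (at_right 0)"
  shows "((\<lambda>h. (w h - w 0) /\<^sub>R h) \<longlongrightarrow> L) (at_right 0)"
proof (rule tendstoI)
  fix e :: real assume e: "e > 0"
  have "\<forall>\<^sub>F r in at_right 0. dist (g r) L < e / 2"
    using lim e by (intro tendstoD) auto
  then obtain d where d: "d > 0" "\<And>r. 0 < r \<Longrightarrow> r < d \<Longrightarrow> dist (g r) L < e / 2"
    by (auto simp: eventually_at_right_field)
  have "dist ((w h - w 0) /\<^sub>R h) L < e" if h: "0 < h" "h < min b d" for h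
  proof -
    \<comment> \<open>The zero terms display the values at the left endpoint 0, in the shape of the
      conclusion of the mean value inequality.\<close>
    have *: "norm ((w h - h *\<^sub>R L) - (w 0 - 0 *\<^sub>R L)) \<le> (e / 2) * h - (e / 2) * 0"
    proof (rule differentiable_bound_general[where f' = "\<lambda>r. g r - L" and \<phi>' = "\<lambda>_. e / 2"])
      show "continuous_on {0..h} (\<lambda>r. w r - r *\<^sub>R L)"
        using h by (intro continuous_intros continuous_on_subset[OF cont]) auto
      show "((\<lambda>r. w r - r *\<^sub>R L) has_vector_derivative g r - L) (at r)"
        if "0 < r" "r < h" for r
        using der[of r] that h by (auto intro!: derivative_eq_intros)
      show "(((*) (e / 2)) has_vector_derivative e / 2) (at r)" for r
        by (auto intro!: derivative_eq_intros)
      show "norm (g r - L) \<le> e / 2" if "0 < r" "r < h" for r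
        using d(2)[of r] that h by (simp add: dist_norm)
    qed (use h in \<open>auto intro!: continuous_intros\<close>)
    define X where "X = w h - w 0 - h *\<^sub>R L"
    have "norm X \<le> e / 2 * h" using * by (simp add: X_def algebra_simps)
    hence "norm (X /\<^sub>R h) \<le> e / 2" using h by (simp add: field_simps)
    moreover have "X /\<^sub>R h = (w h - w 0) /\<^sub>R h - L"
      using h by (simp add: X_def scaleR_diff_right)
    ultimately have "dist ((w h - w 0) /\<^sub>R h) L \<le> e / 2" by (simp only: dist_norm)
    thus ?thesis using e by simp
  qed
  thus "\<forall>\<^sub>F h in at_right 0. dist ((w h - w 0) /\<^sub>R h) L < e"
    unfolding eventually_at_right_field using b d by (intro exI[of _ "min b d"]) auto
qed

section \<open>Classical semigroups\<close>

locale c0_semigroup =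
  fixes S :: "real \<Rightarrow> 'a::banach \<Rightarrow>\<^sub>L 'a"
  assumes zero: "S 0 = id_blinfun"
    and add: "0 \<le> s \<Longrightarrow> 0 \<le> t \<Longrightarrow> S (s + t) = S s o\<^sub>L S t"
    and strongly_continuous: "((\<lambda>t. S t x) \<longlongrightarrow> x) (at_right 0)"
begin

text \<open>The graph of the classical generator. As a relation it records membership in the domain
  and the value at once.\<close>

definition generates :: "'a \<Rightarrow> 'a \<Rightarrow> bool"
  where "generates x y \<longleftrightarrow> ((\<lambda>h. (S h x - x) /\<^sub>R h) \<longlongrightarrow> y) (at_right 0)"

lemma generates_unique: "generates x y \<Longrightarrow> generates x y' \<Longrightarrow> y = y'"
  unfolding generates_def by (rule tendsto_unique[OF trivial_limit_at_right_real])

lemma add_apply: "0 \<le> s \<Longrightarrow> 0 \<le> t \<Longrightarrow> S (s + t) x = S s (S t x)"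
  by (simp add: add)

section \<open>Local bounds and joint continuity of the semigroup\<close>

lemma tendsto_at_zero:
  assumes "(\<tau> \<longlongrightarrow> 0) F" "\<forall>\<^sub>F z in F. 0 \<le> \<tau> z"
  shows "((\<lambda>z. S (\<tau> z) x) \<longlongrightarrow> x) F"
proof -
  \<comment> \<open>Since \<open>S 0\<close> is the identity, the limit from the right is also a
    limit within \<open>{0..}\<close>; this admits parameters \<open>\<tau>\<close> that take the
    value 0.\<close>
  have *: "((\<lambda>t. S t x) \<longlongrightarrow> S 0 x) (at 0 within {0..})"
    using strongly_continuous[of x] by (simp add: zero at_within_Ici_at_right)
  have "((\<lambda>z. S (\<tau> z) x) \<longlongrightarrow> S 0 x) F"
    by (rule continuous_within_tendsto_compose[where S = "{0..}" and f = "\<lambda>t. S t x"])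
      (simp_all add: * assms continuous_within)
  thus ?thesis by (simp add: zero)
qed

text \<open>Otherwise there are times \<open>\<tau> n\<close> tending to 0 at which the norm exceeds
  \<open>n\<close>. Strong continuity makes these operators pointwise bounded, which contradicts
  uniform boundedness.\<close>

lemma bounded_near_zero: "\<exists>d>0. \<exists>M. \<forall>t\<in>{0..d}. norm (S t) \<le> M"
proof (rule ccontr)
  assume contr: "\<not> ?thesis"
  have "\<exists>t\<in>{0..inverse (real (Suc n))}. \<not> norm (S t) \<le> real n" for n
    using contr by (metis inverse_positive_iff_positive of_nat_0_less_iff zero_less_Suc)
  then obtain \<tau> where \<tau>: "\<And>n. \<tau> n \<in> {0..inverse (real (Suc n))}"
    "\<And>n. \<not> norm (S (\<tau> n)) \<le> real n"
    by metis
  have "\<tau> \<longlonglongrightarrow> 0"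
    by (rule tendsto_sandwich[OF _ _ tendsto_const LIMSEQ_inverse_real_of_nat]) (use \<tau> in auto)
  hence "(\<lambda>n. S (\<tau> n) x) \<longlonglongrightarrow> x" for x
    by (rule tendsto_at_zero) (use \<tau> in auto)
  hence "bounded (range (\<lambda>n. S (\<tau> n)))"
    by (intro uniform_boundedness convergent_imp_bounded)
  then obtain B where B: "\<And>n. norm (S (\<tau> n)) \<le> B" by (auto simp: bounded_iff)
  obtain n :: nat where "B \<le> real n" using real_arch_simple by blast
  with B[of n] \<tau>(2)[of n] show False by linarith
qed

text \<open>The bound near 0 is propagated by splitting off a time step of length \<open>d\<close>
  with the semigroup law, each step costing a factor \<open>M\<close>.\<close>

lemma locally_bounded: "\<exists>M>0. \<forall>t\<in>{0..b}. norm (S t) \<le> M"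
proof -
  obtain d M where d: "d > 0" and "\<forall>t\<in>{0..d}. norm (S t) \<le> M"
    using bounded_near_zero by blast
  hence M: "norm (S t) \<le> M" if "0 \<le> t" "t \<le> d" for t using that by simp
  have M0: "0 \<le> M" using M[of 0] d by (smt (verit) norm_ge_zero)
  have bd: "\<exists>K. \<forall>t\<in>{0..real n * d}. norm (S t) \<le> K" for n
  proof (induction n)
    case 0
    show ?case by auto
  next
    case (Suc n)
    then obtain K where "\<forall>t\<in>{0..real n * d}. norm (S t) \<le> K" by blast
    hence K: "norm (S t) \<le> K" if "0 \<le> t" "t \<le> real n * d" for t using that by simp
    have "norm (S t) \<le> max M (M * K)" if t: "0 \<le> t" "t \<le> real (Suc n) * d" for t
    proof (cases "t \<le> d")
      case True
      thus ?thesis using M[of t] t by simp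
    next
      case False
      have "norm (S (d + (t - d))) \<le> norm (S d) * norm (S (t - d))"
        using False d by (subst add) (auto intro: norm_blinfun_compose)
      also have "\<dots> \<le> M * K"
        using False d t M0 by (intro mult_mono M K) (auto simp: algebra_simps)
      finally show ?thesis by simp
    qed
    thus ?case by (intro exI[of _ "max M (M * K)"]) auto
  qed
  obtain n :: nat where "b / d \<le> real n" using real_arch_simple by blast
  hence n: "b \<le> real n * d" using d by (simp add: field_simps)
  obtain K where "\<forall>t\<in>{0..real n * d}. norm (S t) \<le> K" using bd by blast
  \<comment> \<open>The maximum with 1 makes the bound strictly positive.\<close>
  thus ?thesis using n by (intro exI[of _ "max K 1"]) force
qed

text \<open>The difference is split as \<open>S (\<tau> z) (g z - x)\<close> plus
  \<open>S (\<tau> z) x - S t x\<close>. The norm bound on the interval from 0 to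
  \<open>t + 1\<close> controls both summands.\<close>

lemma tendsto_apply:
  assumes \<tau>: "(\<tau> \<longlongrightarrow> t) F" "\<forall>\<^sub>F z in F. 0 \<le> \<tau> z" and t: "0 \<le> t" and g: "(g \<longlongrightarrow> x) F"
  shows "((\<lambda>z. S (\<tau> z) (g z)) \<longlongrightarrow> S t x) F"
proof -
  obtain M where M: "M > 0" "\<And>s. 0 \<le> s \<Longrightarrow> s \<le> t + 1 \<Longrightarrow> norm (S s) \<le> M"
    using locally_bounded[of "t + 1"] by auto
  have Mapply: "norm (S s y) \<le> M * norm y" if "0 \<le> s" "s \<le> t + 1" for s y
    using norm_blinfun[of "S s" y] M(2)[OF that] mult_right_mono[OF _ norm_ge_zero]
    by (meson order_trans)
  have "((\<lambda>z. \<bar>\<tau> z - t\<bar>) \<longlongrightarrow> 0) F"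
    using \<tau>(1) by (simp add: LIM_zero tendsto_rabs_zero)
  hence "((\<lambda>z. S \<bar>\<tau> z - t\<bar> x) \<longlongrightarrow> x) F" by (rule tendsto_at_zero) simp
  with g have lim: "((\<lambda>z. M * norm (g z - x) + M * norm (S \<bar>\<tau> z - t\<bar> x - x)) \<longlongrightarrow>
      M * 0 + M * 0) F"
    by (intro tendsto_intros tendsto_norm_zero LIM_zero)
  have bound: "\<forall>\<^sub>F z in F. norm (S (\<tau> z) (g z) - S t x) \<le>
      M * norm (g z - x) + M * norm (S \<bar>\<tau> z - t\<bar> x - x)"
  proof -
    have "\<forall>\<^sub>F z in F. \<tau> z < t + 1" using \<tau>(1) by (rule order_tendstoD) simp
    with \<tau>(2) show ?thesis
    proof eventually_elim
      case (elim z)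
      \<comment> \<open>Factoring out the smaller time leaves the nonnegative increment
        \<open>\<bar>\<tau> z - t\<bar>\<close>, so approach from the left also reduces to
        continuity at 0.\<close>
      have "norm (S (\<tau> z) x - S t x) = norm (S (min (\<tau> z) t) (S \<bar>\<tau> z - t\<bar> x - x))"
        using elim t add_apply[of t "\<tau> z - t" x] add_apply[of "\<tau> z" "t - \<tau> z" x]
        by (cases "\<tau> z \<le> t") (auto simp: min_def blinfun.diff_right norm_minus_commute)
      also have "\<dots> \<le> M * norm (S \<bar>\<tau> z - t\<bar> x - x)"
        using elim t by (intro Mapply) auto
      finally have "norm (S (\<tau> z) x - S t x) \<le> M * norm (S \<bar>\<tau> z - t\<bar> x - x)" .
      moreover have "norm (S (\<tau> z) (g z - x)) \<le> M * norm (g z - x)"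
        using elim by (intro Mapply) auto
      ultimately have "norm (S (\<tau> z) (g z - x) + (S (\<tau> z) x - S t x)) \<le>
          M * norm (g z - x) + M * norm (S \<bar>\<tau> z - t\<bar> x - x)"
        by (intro norm_triangle_mono)
      thus ?case by (simp add: blinfun.diff_right)
    qed
  qed
  have "((\<lambda>z. S (\<tau> z) (g z) - S t x) \<longlongrightarrow> 0) F"
    using Lim_null_comparison[OF bound] lim by simp
  thus ?thesis by (simp add: LIM_zero_iff)
qed

lemma continuous_on_apply:
  assumes "continuous_on A \<tau>" "continuous_on A g" "\<And>z. z \<in> A \<Longrightarrow> 0 \<le> \<tau> z"
  shows "continuous_on A (\<lambda>z. S (\<tau> z) (g z))"
  unfolding continuous_on_def
proof
  fix z assume z: "z \<in> A"
  have "\<forall>\<^sub>F y in at z within A. 0 \<le> \<tau> y"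
    using assms(3) by (auto simp: eventually_at_filter)
  thus "((\<lambda>z. S (\<tau> z) (g z)) \<longlongrightarrow> S (\<tau> z) (g z)) (at z within A)"
    using z assms by (intro tendsto_apply) (auto simp: continuous_on_def)
qed

section \<open>Derivatives along orbits and classical uniqueness\<close>

lemma generates_apply:
  assumes "generates x y" "0 \<le> t"
  shows "generates (S t x) (S t y)"
  unfolding generates_def
proof (rule Lim_transform_eventually)
  show "((\<lambda>h. S t ((S h x - x) /\<^sub>R h)) \<longlongrightarrow> S t y) (at_right 0)"
    using assms unfolding generates_def by (intro tendsto_intros)
  \<comment> \<open>\<open>S t\<close> and \<open>S h\<close> commute because both products equal
    \<open>S (t + h)\<close>.\<close>
  have "S t ((S h x - x) /\<^sub>R h) = (S h (S t x) - S t x) /\<^sub>R h" if "h > 0" for h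
    using that assms(2) add_apply[of t h x] add_apply[of h t x]
    by (simp add: blinfun.scaleR_right blinfun.diff_right add.commute)
  thus "\<forall>\<^sub>F h in at_right 0. S t ((S h x - x) /\<^sub>R h) = (S h (S t x) - S t x) /\<^sub>R h"
    by (auto simp: eventually_at_filter)
qed

text \<open>The limit in \<open>generates\<close> is one-sided. Factoring out \<open>S\<close> at
  the smaller of \<open>s\<close> and \<open>s + h\<close> turns the quotient for either sign of
  \<open>h\<close> into a right-hand quotient at \<open>\<bar>h\<bar>\<close>; joint continuity then
  gives the two-sided limit.\<close>

lemma has_vector_derivative_orbit:
  assumes "generates x y" "0 < s"
  shows "((\<lambda>r. S r x) has_vector_derivative S s y) (at s)"
  unfolding has_vector_derivative_iff_quotient
proof (rule Lim_transform_eventually)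
  have abs0: "filterlim abs (at_right 0) (at (0::real))"
    unfolding filterlim_at by (auto intro!: tendsto_eq_intros simp: eventually_at_filter)
  have ev: "\<forall>\<^sub>F h in at (0::real). 0 < s + h"
    using order_tendstoD(1)[OF tendsto_add[OF tendsto_const tendsto_ident_at], of 0 s 0] assms
    by simp
  show "((\<lambda>h. S (min (s + h) s) ((S \<bar>h\<bar> x - x) /\<^sub>R \<bar>h\<bar>)) \<longlongrightarrow> S s y) (at 0)"
  proof (rule tendsto_apply)
    show "((\<lambda>h. min (s + h) s) \<longlongrightarrow> s) (at 0)"
      by (auto intro!: tendsto_eq_intros)
    show "\<forall>\<^sub>F h in at 0. 0 \<le> min (s + h) s"
      using ev by eventually_elim (use assms in auto)
    show "((\<lambda>h. (S \<bar>h\<bar> x - x) /\<^sub>R \<bar>h\<bar>) \<longlongrightarrow> y) (at 0)"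
      using filterlim_compose[OF assms(1)[unfolded generates_def] abs0] .
  qed (use assms in simp)
  show "\<forall>\<^sub>F h in at 0. S (min (s + h) s) ((S \<bar>h\<bar> x - x) /\<^sub>R \<bar>h\<bar>) = (S (s + h) x - S s x) /\<^sub>R h"
    using ev
  proof eventually_elim
    case (elim h)
    show ?case
    proof (cases "h \<ge> 0")
      case True
      thus ?thesis using assms add_apply[of s h x]
        by (simp add: min_def blinfun.scaleR_right blinfun.diff_right)
    next
      case False
      \<comment> \<open>For negative \<open>h\<close> the factored time is \<open>s + h\<close>, and
        numerator and denominator both change sign.\<close>
      hence "S s x = S (s + h) (S (- h) x)"
        using elim add_apply[of "s + h" "- h" x] by simp
      thus ?thesis using False
        by (simp add: min_def blinfun.scaleR_right blinfun.diff_right algebra_simps)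
    qed
  qed
qed

text \<open>A product rule: one term moves \<open>w\<close> under the operators, handled by joint
  continuity; the other moves time along the orbit of the fixed vector \<open>w s\<close>, handled
  by the chain rule.\<close>

lemma has_vector_derivative_apply_reversed:
  assumes w: "(w has_vector_derivative w') (at s)" and y: "generates (w s) y" and s: "s < t"
  shows "((\<lambda>r. S (t - r) (w r)) has_vector_derivative S (t - s) w' - S (t - s) y) (at s)"
  unfolding has_vector_derivative_iff_quotient
proof (rule Lim_transform_eventually)
  have "((\<lambda>r. S r (w s)) \<circ> (\<lambda>r. t - r) has_vector_derivative (- 1) *\<^sub>R S (t - s) y) (at s)"
    by (rule vector_diff_chain_at)
      (use s y in \<open>auto intro!: derivative_eq_intros has_vector_derivative_orbit\<close>)
  hence 1: "((\<lambda>h. (S (t - (s + h)) (w s) - S (t - s) (w s)) /\<^sub>R h) \<longlongrightarrow> - S (t - s) y) (at 0)"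
    by (simp add: has_vector_derivative_iff_quotient)
  have 2: "((\<lambda>h. S (t - (s + h)) ((w (s + h) - w s) /\<^sub>R h)) \<longlongrightarrow> S (t - s) w') (at 0)"
  proof (rule tendsto_apply)
    show *: "((\<lambda>h. t - (s + h)) \<longlongrightarrow> t - s) (at 0)"
      by (auto intro!: tendsto_eq_intros)
    show "\<forall>\<^sub>F h in at 0. 0 \<le> t - (s + h)"
      using order_tendstoD(1)[OF *, of 0] s by (auto elim: eventually_mono)
  qed (use w s in \<open>auto simp: has_vector_derivative_iff_quotient\<close>)
  show "((\<lambda>h. S (t - (s + h)) ((w (s + h) - w s) /\<^sub>R h) +
      (S (t - (s + h)) (w s) - S (t - s) (w s)) /\<^sub>R h) \<longlongrightarrow> S (t - s) w' - S (t - s) y) (at 0)"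
    using tendsto_add[OF 2 1] by simp
  \<comment> \<open>Adding and subtracting \<open>U q\<close>, used with
    \<open>U = S (t - (s + h))\<close>, \<open>p = w (s + h)\<close>, \<open>q = w s\<close> and
    \<open>z = S (t - s) (w s)\<close>.\<close>
  have "U ((p - q) /\<^sub>R h) + (U q - z) /\<^sub>R h = (U p - z) /\<^sub>R h"
    for U :: "'a \<Rightarrow>\<^sub>L 'a" and p q z h
    by (simp add: blinfun.scaleR_right blinfun.diff_right scaleR_diff_right)
  thus "\<forall>\<^sub>F h in at 0. S (t - (s + h)) ((w (s + h) - w s) /\<^sub>R h) +
      (S (t - (s + h)) (w s) - S (t - s) (w s)) /\<^sub>R h =
      (S (t - (s + h)) (w (s + h)) - S (t - s) (w s)) /\<^sub>R h"
    by (intro always_eventually allI)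
qed

lemma cauchy_problem_unique:
  assumes cont: "continuous_on {0..} w"
    and der: "\<And>r. 0 < r \<Longrightarrow> \<exists>y. generates (w r) y \<and> (w has_vector_derivative y) (at r)"
    and t: "0 \<le> t"
  shows "w t = S t (w 0)"
proof (cases "t = 0")
  case False
  hence "0 < t" using t by simp
  let ?f = "\<lambda>s. S (t - s) (w s)"
  \<comment> \<open>A zero bound forces equal endpoint values: \<open>w t\<close> at
    \<open>s = t\<close> and \<open>S t (w 0)\<close> at \<open>s = 0\<close>. Only continuity is
    required at the endpoints, where the derivative may fail to exist.\<close>
  have "norm (?f t - ?f 0) \<le> (\<lambda>_. 0) t - (\<lambda>_. 0) (0::real)"
  proof (rule differentiable_bound_general[where f = ?f and \<phi> = "\<lambda>_. 0"
        and \<phi>' = "\<lambda>_. 0" and f' = "\<lambda>_. 0"])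
    show "continuous_on {0..t} (\<lambda>s. S (t - s) (w s))"
      by (intro continuous_on_apply continuous_intros continuous_on_subset[OF cont]) auto
    show "((\<lambda>s. S (t - s) (w s)) has_vector_derivative 0) (at s)" if "0 < s" "s < t" for s
    proof -
      obtain y where "generates (w s) y" "(w has_vector_derivative y) (at s)"
        using der \<open>0 < s\<close> by blast
      from has_vector_derivative_apply_reversed[OF this(2,1) \<open>s < t\<close>] show ?thesis by simp
    qed
  qed (use \<open>0 < t\<close> in auto)
  thus ?thesis by (simp add: zero)
qed (simp add: zero)

end

section \<open>Conformable derivatives\<close>

text \<open>For fixed \<open>t\<close> the factor \<open>t powr (1 - \<alpha>)\<close> is a positive
  constant, so the conformable quotient is an ordinary one after an affine change of variable,
  inverted for the converse.\<close>

lemma has_conf_deriv_iff_has_vector_derivative: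
  assumes "t > 0"
  shows "has_conf_deriv \<alpha> f D t \<longleftrightarrow> (f has_vector_derivative t powr (\<alpha> - 1) *\<^sub>R D) (at t)"
proof -
  define c where "c = t powr (1 - \<alpha>)"
  have c: "c > 0" "t powr (\<alpha> - 1) = 1 / c"
    using assms by (auto simp: c_def powr_diff)
  have "has_conf_deriv \<alpha> f D t \<longleftrightarrow> ((\<lambda>\<epsilon>. f (t + \<epsilon> * c)) has_vector_derivative D) (at 0)"
    using assms by (simp add: has_conf_deriv_def has_vector_derivative_iff_quotient c_def)
  also have "\<dots> \<longleftrightarrow> (f has_vector_derivative (1 / c) *\<^sub>R D) (at t)"
  proof
    assume "((\<lambda>\<epsilon>. f (t + \<epsilon> * c)) has_vector_derivative D) (at 0)"
    hence "((\<lambda>\<epsilon>. f (t + \<epsilon> * c)) \<circ> (\<lambda>r. (r - t) / c) has_vector_derivative (1 / c) *\<^sub>R D) (at t)"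
      using c by (intro vector_diff_chain_at) (auto intro!: derivative_eq_intros)
    thus "(f has_vector_derivative (1 / c) *\<^sub>R D) (at t)"
      using c by (simp add: o_def)
  next
    assume "(f has_vector_derivative (1 / c) *\<^sub>R D) (at t)"
    hence "(f \<circ> (\<lambda>\<epsilon>. t + \<epsilon> * c) has_vector_derivative c *\<^sub>R (1 / c) *\<^sub>R D) (at 0)"
      by (intro vector_diff_chain_at) (auto intro!: derivative_eq_intros)
    thus "((\<lambda>\<epsilon>. f (t + \<epsilon> * c)) has_vector_derivative D) (at 0)"
      using c by (simp add: o_def)
  qed
  finally show ?thesis by (simp add: c)
qed

lemma has_vector_derivative_powr:
  assumes "(r::real) > 0"
  shows "((\<lambda>r. r powr a) has_vector_derivative a * r powr (a - 1)) (at r)"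
  using has_real_derivative_powr[OF assms, of a]
  by (simp add: has_real_derivative_iff_has_vector_derivative)

text \<open>The chain rule along the mutually inverse powers \<open>1 / \<alpha>\<close> and
  \<open>\<alpha>\<close>: the powers of \<open>t\<close> cancel and only the factor \<alpha>
  survives.\<close>

lemma has_conf_deriv_iff_substitution:
  assumes t: "t > 0" and \<alpha>: "\<alpha> > 0"
  shows "has_conf_deriv \<alpha> f D t \<longleftrightarrow>
    ((\<lambda>r. f (r powr (1 / \<alpha>))) has_vector_derivative D /\<^sub>R \<alpha>) (at (t powr \<alpha>))"
  unfolding has_conf_deriv_iff_has_vector_derivative[OF t]
proof
  assume *: "(f has_vector_derivative t powr (\<alpha> - 1) *\<^sub>R D) (at t)"
  have "(f \<circ> (\<lambda>r. r powr (1 / \<alpha>)) has_vector_derivative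
      (1 / \<alpha> * (t powr \<alpha>) powr (1 / \<alpha> - 1)) *\<^sub>R t powr (\<alpha> - 1) *\<^sub>R D) (at (t powr \<alpha>))"
    using t \<alpha> * by (intro vector_diff_chain_at has_vector_derivative_powr) (auto simp: powr_powr)
  moreover have "1 / \<alpha> * (t powr \<alpha>) powr (1 / \<alpha> - 1) * t powr (\<alpha> - 1) = inverse \<alpha>"
  proof -
    have "\<alpha> * (1 / \<alpha> - 1) + (\<alpha> - 1) = 0" using \<alpha> by (simp add: field_simps)
    hence "(t powr \<alpha>) powr (1 / \<alpha> - 1) * t powr (\<alpha> - 1) = 1"
      using t by (simp add: powr_powr flip: powr_add)
    thus ?thesis by (simp only: mult.assoc) (simp add: divide_inverse)
  qed
  ultimately show "((\<lambda>r. f (r powr (1 / \<alpha>))) has_vector_derivative D /\<^sub>R \<alpha>) (at (t powr \<alpha>))"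
    by (simp only: o_def scaleR_scaleR)
next
  assume *: "((\<lambda>r. f (r powr (1 / \<alpha>))) has_vector_derivative D /\<^sub>R \<alpha>) (at (t powr \<alpha>))"
  have "((\<lambda>r. f (r powr (1 / \<alpha>))) \<circ> (\<lambda>r. r powr \<alpha>) has_vector_derivative
      (\<alpha> * t powr (\<alpha> - 1)) *\<^sub>R (D /\<^sub>R \<alpha>)) (at t)"
    using t * by (intro vector_diff_chain_at has_vector_derivative_powr) auto
  moreover have "\<alpha> * t powr (\<alpha> - 1) * inverse \<alpha> = t powr (\<alpha> - 1)"
    using \<alpha> by (simp add: field_simps)
  ultimately have
    "((\<lambda>r. f ((r powr \<alpha>) powr (1 / \<alpha>))) has_vector_derivative t powr (\<alpha> - 1) *\<^sub>R D) (at t)"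
    by (simp only: o_def scaleR_scaleR)
  \<comment> \<open>The powers cancel for positive \<open>r\<close>, hence on an open set containing
    \<open>t\<close>.\<close>
  thus "(f has_vector_derivative t powr (\<alpha> - 1) *\<^sub>R D) (at t)"
    by (rule has_vector_derivative_transform_within_open[where S = "{0<..}"])
      (use t \<alpha> in \<open>auto simp: powr_powr\<close>)
qed

lemma has_conf_deriv_zero_iff:
  "has_conf_deriv \<alpha> f D 0 \<longleftrightarrow>
    (\<exists>b>0. \<exists>g. (\<forall>s\<in>{0<..<b}. has_conf_deriv \<alpha> f (g s) s) \<and> (g \<longlongrightarrow> D) (at_right 0))"
  unfolding has_conf_deriv_def by auto

lemma conf_deriv_eq:
  assumes "t > 0" "has_conf_deriv \<alpha> f D t"
  shows "conf_deriv \<alpha> f t = D"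
  unfolding conf_deriv_def using assms
  by (intro the_equality) (auto simp: has_conf_deriv_def intro: LIM_unique)

lemma filterlim_powr_at_right_zero:
  assumes "(p::real) > 0"
  shows "filterlim (\<lambda>r. r powr p) (at_right 0) (at_right 0)"
  unfolding filterlim_at
proof
  show "\<forall>\<^sub>F r in at_right 0. r powr p \<in> {0<..} \<and> r powr p \<noteq> 0"
    by (auto simp: eventually_at_filter)
  show "((\<lambda>r. r powr p) \<longlongrightarrow> 0) (at_right 0)"
    by (rule tendsto_eq_rhs[OF tendsto_powr'[OF tendsto_ident_at tendsto_const]])
      (use assms in \<open>auto simp: eventually_at_filter\<close>)
qed

lemma continuous_on_powr_nonneg:
  assumes "(p::real) > 0"
  shows "continuous_on {0..} (\<lambda>r. r powr p)"
  using assms by (intro continuous_on_powr' continuous_intros) auto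

section \<open>The \<open>\<alpha>\<close>-abstract Cauchy problem\<close>

lemma c0_semigroup_substitution:
  assumes "\<alpha> > 0" "c0_alpha_semigroup \<alpha> T"
  shows "c0_semigroup (\<lambda>r. T (r powr (1 / \<alpha>)))"
proof
  fix x
  have "((\<lambda>t. T t x) \<longlongrightarrow> x) (at_right 0)"
    using assms by (simp add: c0_alpha_semigroup_def)
  from filterlim_compose[OF this filterlim_powr_at_right_zero[of "1 / \<alpha>"]]
  show "((\<lambda>t. T (t powr (1 / \<alpha>)) x) \<longlongrightarrow> x) (at_right 0)"
    using assms by simp
qed (use assms in \<open>auto simp: c0_alpha_semigroup_def alpha_semigroup_def\<close>)

context
  fixes \<alpha> :: real and T :: "real \<Rightarrow> 'a::banach \<Rightarrow>\<^sub>L 'a"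
  assumes \<alpha>: "0 < \<alpha>" and T: "c0_alpha_semigroup \<alpha> T"
begin

interpretation S: c0_semigroup "\<lambda>r. T (r powr (1 / \<alpha>))"
  using \<alpha> T by (rule c0_semigroup_substitution)

section \<open>The generator under the change of time\<close>

lemma has_conf_deriv_orbit:
  assumes "S.generates x y" "0 < t"
  shows "has_conf_deriv \<alpha> (\<lambda>t. T t x) (\<alpha> *\<^sub>R T t y) t"
  using S.has_vector_derivative_orbit[OF assms(1), of "t powr \<alpha>"] assms(2) \<alpha>
  by (simp add: has_conf_deriv_iff_substitution powr_powr)

text \<open>From right to left, the conformable derivative of the orbit at \<open>s\<close> is
  \<open>\<alpha> *\<^sub>R T s (D /\<^sub>R \<alpha>)\<close>, which tends to \<open>D\<close> by
  strong continuity. From left to right, the limit of derivatives is a right derivative of the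
  substituted orbit.\<close>

lemma has_conf_deriv_zero_iff_generates:
  "has_conf_deriv \<alpha> (\<lambda>t. T t x) D 0 \<longleftrightarrow> S.generates x (D /\<^sub>R \<alpha>)"
proof
  assume "S.generates x (D /\<^sub>R \<alpha>)"
  moreover have "((\<lambda>s. \<alpha> *\<^sub>R T s (D /\<^sub>R \<alpha>)) \<longlongrightarrow> D) (at_right 0)"
  proof (rule tendsto_eq_rhs)
    show "((\<lambda>s. \<alpha> *\<^sub>R T s (D /\<^sub>R \<alpha>)) \<longlongrightarrow> \<alpha> *\<^sub>R (D /\<^sub>R \<alpha>)) (at_right 0)"
      using T by (intro tendsto_intros) (auto simp: c0_alpha_semigroup_def)
  qed (use \<alpha> in simp)
  ultimately show "has_conf_deriv \<alpha> (\<lambda>t. T t x) D 0"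
    unfolding has_conf_deriv_zero_iff
    by (intro exI[of _ "1::real"] conjI exI[of _ "\<lambda>s. \<alpha> *\<^sub>R T s (D /\<^sub>R \<alpha>)"] ballI)
      (auto intro: has_conf_deriv_orbit)
next
  assume "has_conf_deriv \<alpha> (\<lambda>t. T t x) D 0"
  then obtain b g where b: "b > 0" and g: "(g \<longlongrightarrow> D) (at_right 0)"
    and der: "\<And>s. 0 < s \<Longrightarrow> s < b \<Longrightarrow> has_conf_deriv \<alpha> (\<lambda>t. T t x) (g s) s"
    unfolding has_conf_deriv_zero_iff by auto
  \<comment> \<open>The term at \<open>0 powr (1 / \<alpha>)\<close> is the substituted orbit at 0,
    which is \<open>x\<close>; the interval bound \<open>b\<close> becomes
    \<open>b powr \<alpha>\<close> in the new time.\<close>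
  have "((\<lambda>h. (T (h powr (1 / \<alpha>)) x - T (0 powr (1 / \<alpha>)) x) /\<^sub>R h) \<longlongrightarrow> D /\<^sub>R \<alpha>) (at_right 0)"
  proof (rule right_derivative_eq_limit_of_derivatives)
    show "b powr \<alpha> > 0" using b by simp
    show "continuous_on {0..<b powr \<alpha>} (\<lambda>h. T (h powr (1 / \<alpha>)) x)"
      by (rule S.continuous_on_apply) (auto intro: continuous_intros)
    show "((\<lambda>h. g (h powr (1 / \<alpha>)) /\<^sub>R \<alpha>) \<longlongrightarrow> D /\<^sub>R \<alpha>) (at_right 0)"
      using filterlim_compose[OF g filterlim_powr_at_right_zero[of "1 / \<alpha>"]] \<alpha>
      by (intro tendsto_intros) auto
    show "((\<lambda>h. T (h powr (1 / \<alpha>)) x) has_vector_derivative g (r powr (1 / \<alpha>)) /\<^sub>R \<alpha>) (at r)"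
      if r: "0 < r" "r < b powr \<alpha>" for r
    proof -
      have "r powr (1 / \<alpha>) < (b powr \<alpha>) powr (1 / \<alpha>)"
        using r \<alpha> by (intro powr_less_mono2) auto
      hence "r powr (1 / \<alpha>) < b" using b \<alpha> by (simp add: powr_powr)
      with der[of "r powr (1 / \<alpha>)"] r \<alpha> show ?thesis
        by (simp add: has_conf_deriv_iff_substitution powr_powr)
    qed
  qed
  thus "S.generates x (D /\<^sub>R \<alpha>)"
    using S.zero by (simp add: S.generates_def)
qed

lemma generator_domain_iff: "x \<in> generator_domain \<alpha> T \<longleftrightarrow> (\<exists>y. S.generates x y)"
proof -
  \<comment> \<open>This rewriting supplies the witness \<open>\<alpha> *\<^sub>R y\<close> for the
    conformable derivative at 0.\<close>
  have "S.generates x y \<Longrightarrow> S.generates x ((\<alpha> *\<^sub>R y) /\<^sub>R \<alpha>)" for y using \<alpha> by simp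
  thus ?thesis
    unfolding generator_domain_def conf_differentiable_def
    using has_conf_deriv_zero_iff_generates by blast
qed

lemma generator_eq:
  assumes "S.generates x y"
  shows "generator \<alpha> T x = \<alpha> *\<^sub>R y"
  unfolding generator_def conf_deriv_def has_conf_deriv_zero_iff_generates
proof (rule the_equality)
  show "S.generates x ((\<alpha> *\<^sub>R y) /\<^sub>R \<alpha>)" using assms \<alpha> by simp
  show "D = \<alpha> *\<^sub>R y" if "S.generates x (D /\<^sub>R \<alpha>)" for D
    using S.generates_unique[OF assms that] \<alpha> by simp
qed

section \<open>Existence and uniqueness of the solution\<close>

lemma cauchy_solution_orbit:
  assumes "u\<^sub>0 \<in> generator_domain \<alpha> T"
  shows "cauchy_solution \<alpha> (generator_domain \<alpha> T) (generator \<alpha> T) u\<^sub>0 (\<lambda>t. T t u\<^sub>0)"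
proof -
  obtain y where y: "S.generates u\<^sub>0 y"
    using assms generator_domain_iff by blast
  have cont: "continuous_on {0..} (\<lambda>t. T t x)" for x
  proof (rule continuous_on_eq)
    show "continuous_on {0..} (\<lambda>t. T ((t powr \<alpha>) powr (1 / \<alpha>)) x)"
      using \<alpha> by (intro S.continuous_on_apply continuous_on_powr_nonneg continuous_intros) auto
  qed (use \<alpha> in \<open>auto simp: powr_powr\<close>)
  \<comment> \<open>This one fact yields both the invariance of the domain and the value of the
    generator along the orbit.\<close>
  have gen: "S.generates (T t u\<^sub>0) (T t y)" if "t > 0" for t
    using S.generates_apply[OF y, of "t powr \<alpha>"] that \<alpha> by (simp add: powr_powr)
  have der: "conf_deriv \<alpha> (\<lambda>t. T t u\<^sub>0) t = \<alpha> *\<^sub>R T t y" if "t > 0" for t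
    using conf_deriv_eq[OF that] has_conf_deriv_orbit[OF y that] .
  show ?thesis
    unfolding cauchy_solution_def
  proof (intro conjI allI impI)
    show "conf_differentiable \<alpha> (\<lambda>t. T t u\<^sub>0) t" if "0 < t" for t
      unfolding conf_differentiable_def using has_conf_deriv_orbit[OF y that] by blast
    have "continuous_on {0<..} (\<lambda>t. \<alpha> *\<^sub>R T t y)"
      by (intro continuous_intros continuous_on_subset[OF cont]) auto
    thus "continuous_on {0<..} (conf_deriv \<alpha> (\<lambda>t. T t u\<^sub>0))"
      by (rule continuous_on_eq) (simp add: der)
    show "T t u\<^sub>0 \<in> generator_domain \<alpha> T" if "0 < t" for t
      using gen[OF that] generator_domain_iff by blast
    show "conf_deriv \<alpha> (\<lambda>t. T t u\<^sub>0) t = generator \<alpha> T (T t u\<^sub>0)" if "0 < t" for t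
      using der[OF that] generator_eq[OF gen[OF that]] by simp
  qed (use cont S.zero in auto)
qed

lemma cauchy_solution_unique:
  assumes v: "cauchy_solution \<alpha> (generator_domain \<alpha> T) (generator \<alpha> T) u\<^sub>0 v" and t: "0 \<le> t"
  shows "v t = T t u\<^sub>0"
proof -
  let ?w = "\<lambda>r. v (r powr (1 / \<alpha>))"
  \<comment> \<open>Classical uniqueness is evaluated at \<open>t powr \<alpha>\<close>, so that
    undoing the substitution returns \<open>v t\<close>; the initial value survives because
    \<open>0 powr (1 / \<alpha>)\<close> is 0.\<close>
  have "?w (t powr \<alpha>) = T ((t powr \<alpha>) powr (1 / \<alpha>)) (?w 0)"
  proof (rule S.cauchy_problem_unique)
    show "continuous_on {0..} ?w"
      by (rule continuous_on_compose2[of "{0..}" v])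
        (use v \<alpha> in \<open>auto simp: cauchy_solution_def intro: continuous_on_powr_nonneg\<close>)
    fix r :: real assume r: "0 < r"
    let ?s = "r powr (1 / \<alpha>)"
    have s: "0 < ?s" using r by simp
    obtain D where D: "has_conf_deriv \<alpha> v D ?s"
      using v s unfolding cauchy_solution_def conf_differentiable_def by blast
    obtain y where y: "S.generates (v ?s) y"
      using v s unfolding cauchy_solution_def generator_domain_iff by blast
    \<comment> \<open>The equation gives the factor \<alpha>, which the substitution divides out
      again, leaving the classical equation with derivative \<open>y\<close>.\<close>
    have "D = \<alpha> *\<^sub>R y"
      using v s conf_deriv_eq[OF s D] generator_eq[OF y] by (simp add: cauchy_solution_def)
    hence "(?w has_vector_derivative y) (at r)"
      using D r \<alpha> by (simp add: has_conf_deriv_iff_substitution powr_powr)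
    with y show "\<exists>y. S.generates (?w r) y \<and> (?w has_vector_derivative y) (at r)" by blast
  qed simp
  thus ?thesis
    using v t \<alpha> by (simp add: powr_powr cauchy_solution_def)
qed

end

theorem theorem2p3:
  fixes \<alpha> :: real
    and T :: "real \<Rightarrow> 'a::banach \<Rightarrow>\<^sub>L 'a"
    and u\<^sub>0 :: 'a
  assumes "0 < \<alpha>" and "\<alpha> \<le> 1"
    and "c0_alpha_semigroup \<alpha> T"
    and "u\<^sub>0 \<in> generator_domain \<alpha> T"
  shows "cauchy_solution \<alpha> (generator_domain \<alpha> T) (generator \<alpha> T) u\<^sub>0
           (\<lambda>t. blinfun_apply (T t) u\<^sub>0) \<and>
         (\<forall>v. cauchy_solution \<alpha> (generator_domain \<alpha> T) (generator \<alpha> T) u\<^sub>0 v \<longrightarrow>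
            (\<forall>t\<ge>0. v t = blinfun_apply (T t) u\<^sub>0))"
  using assms cauchy_solution_orbit cauchy_solution_unique by blast

end
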